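(* For any ordinals $\alpha,\beta < \omega_1$ and any $(\alpha+\beta)$-tree function $g \colon 2^{\mathbb{N}} \rightarrow \{0,1\}$, there is a $\boldsymbol{\Sigma}^0_{\alpha+1}$-measurable function $f \colon 2^{\mathbb{N}} \rightarrow 2^{\mathbb{N}}$ such that, for any restriction $\rho$ such that $f^\rho$ is continuous, the set $(g^\rho)^{-1}(\{1\})$ is a Borel set of rank at most $\beta$.
   Context: Borel classes. $2^{\mathbb{N}}$ has the product topology. A set $S\subseteq 2^{\mathbb{N}}$ is $\boldsymbol{\Sigma}^0_0$ (equivalently $\boldsymbol{\Pi}^0_0$) if it is clopen. For $1\le\alpha<\omega_1$, a set is $\boldsymbol{\Sigma}^0_\alpha$ (resp. $\boldsymbol{\Pi}^0_\alpha$) if it is a countable union (resp. intersection) of sets $S_n$, $n\in\mathbb{N}$, each of which is $\boldsymbol{\Pi}^0_{\beta_n}$ (resp. $\boldsymbol{\Sigma}^0_{\beta_n}$) for some $\beta_n<\alpha$ (for $\alpha\geq 1$ this is the usual Borel hierarchy). The rank of a Borel set $B$ is the smallest $\alpha$ with $B\in\boldsymbol{\Sigma}^0_\alpha\cup\boldsymbol{\Pi}^0_\alpha$. The same definitions are used in $2^I$ for $I\subseteq\mathbb{N}$. A function $f\colon 2^{\mathbb{N}}\to 2^{\mathbb{N}}$ is $\boldsymbol{\Sigma}^0_\alpha$-measurable if $f^{-1}(U)\in\boldsymbol{\Sigma}^0_\alpha$ for every open $U$. Tree functions. The full trees $T_\alpha$ ($\alpha<\omega_1$) are rooted trees defined recursively: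 $T_0$ is a single vertex (the root); $T_{\alpha+1}$ consists of a root whose children are the roots of $\omega$-many disjoint copies of $T_\alpha$; for limit $\alpha$, $T_\alpha$ consists of a root whose children are the roots of $\omega$-many disjoint copies of $T_\beta$ for each $\beta<\alpha$. A full alternating tree of rank $\alpha$ is obtained from $T_\alpha$ by labeling the leaves injectively with variables $x_i$ (positive literals), and labeling each non-leaf vertex with $\wedge$ or $\vee$ so that no $\wedge$-vertex has an $\wedge$-vertex as a child and no $\vee$-vertex has a $\vee$-vertex as a child. On an input $x$, a leaf labeled $x_i$ evaluates to the $i$-th bit of $x$, an $\wedge$-vertex (resp. $\vee$-vertex) evaluates to the conjunction (resp. disjunction) of the values of its children, and the output is the value of the root. A function $g\colon 2^{\mathbb{N}}\to\{0,1\}$ is an $\alpha$-tree function if it is computed by a full alternating tree of rank $\alpha$ (not all variables need appear as labels). Restrictions. A restriction is a function $\rho\colon\mathbb{N}\to\{0,1,*\}$. For a function $f$ on $2^{\mathbb{N}}$, the restricted function $f^\rho$ has domain $2^{\rho^{-1}(\{*\})}$ (product topology): given values for the variables $x_i$ with $\rho(i)=*$, it evaluates $f$ on the input obtained by setting every other $x_i$ to $\rho(i)$. *)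

theory Defs
  imports "HOL-Analysis.Analysis"
begin

section \<open>Countable ordinals\<close>

text \<open>
  A countable ordinal is an isomorphism class of (reflexive) well-orders whose field is a set of
  natural numbers, so that the type below is \<open>\<omega>\<^sub>1\<close>.
\<close>

quotient_type countable_ordinal =
  "nat rel" / partial: "\<lambda>r s. (r, s) \<in> ordIso"
  morphisms rep_countable_ordinal abs_countable_ordinal
proof (rule part_equivpI)
  have "Well_order ({} :: nat rel)" by simp
  then show "\<exists>r :: nat rel. (r, r) \<in> ordIso" by (blast intro: ordIso_reflexive)
  show "symp (\<lambda>r s :: nat rel. (r, s) \<in> ordIso)"
    by (auto intro!: sympI ordIso_symmetric)
  show "transp (\<lambda>r s :: nat rel. (r, s) \<in> ordIso)"
    by (auto intro!: transpI elim: ordIso_transitive)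
qed

text \<open>Order sum: the even numbers carry a copy of \<open>r\<close>, the odd numbers above it a copy of \<open>s\<close>.\<close>

definition nat_osum :: "nat rel \<Rightarrow> nat rel \<Rightarrow> nat rel" where
  "nat_osum r s =
     {(2 * a, 2 * b) | a b. (a, b) \<in> r} \<union>
     {(2 * a + 1, 2 * b + 1) | a b. (a, b) \<in> s} \<union>
     {(2 * a, 2 * b + 1) | a b. a \<in> Field r \<and> b \<in> Field s}"

lemma in_nat_osum_iff [simp]:
  "(2 * a, 2 * b) \<in> nat_osum r s \<longleftrightarrow> (a, b) \<in> r"
  "(Suc (2 * a), Suc (2 * b)) \<in> nat_osum r s \<longleftrightarrow> (a, b) \<in> s"
  "(2 * a, Suc (2 * b)) \<in> nat_osum r s \<longleftrightarrow> a \<in> Field r \<and> b \<in> Field s"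
  "(Suc (2 * a), 2 * b) \<notin> nat_osum r s"
  unfolding nat_osum_def by (auto; presburger)+

lemma Field_nat_osum:
  assumes "Well_order r" "Well_order s"
  shows "Field (nat_osum r s) = (\<lambda>a. 2 * a) ` Field r \<union> (\<lambda>a. Suc (2 * a)) ` Field s"
proof
  show "Field (nat_osum r s) \<subseteq> (\<lambda>a. 2 * a) ` Field r \<union> (\<lambda>a. Suc (2 * a)) ` Field s"
    unfolding nat_osum_def Field_def by auto
  have "(a, a) \<in> r" if "a \<in> Field r" for a
    using assms that by (auto simp: order_on_defs refl_on_def)
  moreover have "(a, a) \<in> s" if "a \<in> Field s" for a
    using assms that by (auto simp: order_on_defs refl_on_def)
  ultimately show "(\<lambda>a. 2 * a) ` Field r \<union> (\<lambda>a. Suc (2 * a)) ` Field s \<subseteq> Field (nat_osum r s)"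
    by (auto intro!: FieldI1[of "2 * _" "2 * _"] FieldI1[of "Suc (2 * _)" "Suc (2 * _)"])
qed

lemma even_odd_cases:
  obtains a :: nat where "n = 2 * a" | a where "n = Suc (2 * a)"
  by (metis oddE evenE Suc_eq_plus1)

lemma Well_order_nat_osum:
  assumes r: "Well_order r" and s: "Well_order s"
  shows "Well_order (nat_osum r s)"
proof -
  let ?t = "nat_osum r s"
  note F = Field_nat_osum[OF r s]
  have lin: "refl_on (Field r) r" "trans r" "antisym r" "total_on (Field r) r"
            "refl_on (Field s) s" "trans s" "antisym s" "total_on (Field s) s"
    and wf: "wf (r - Id)" "wf (s - Id)"
    using r s by (auto simp: order_on_defs)
  have "refl_on (Field ?t) ?t"
    using lin unfolding F by (auto simp: refl_on_def)
  moreover have "trans ?t"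
  proof (rule transI)
    fix x y z assume "(x, y) \<in> ?t" "(y, z) \<in> ?t"
    then show "(x, z) \<in> ?t"
      using lin(2,6)
      by (cases x rule: even_odd_cases; cases y rule: even_odd_cases; cases z rule: even_odd_cases)
         (auto dest: transD intro: FieldI1 FieldI2)
  qed
  moreover have "antisym ?t"
  proof (rule antisymI)
    fix x y assume "(x, y) \<in> ?t" "(y, x) \<in> ?t"
    then show "x = y"
      using lin(3,7)
      by (cases x rule: even_odd_cases; cases y rule: even_odd_cases) (auto dest: antisymD)
  qed
  moreover have "total_on (Field ?t) ?t"
    unfolding F
  proof (rule total_onI)
    fix x y
    assume "x \<in> (\<lambda>a. 2 * a) ` Field r \<union> (\<lambda>a. Suc (2 * a)) ` Field s"
      "y \<in> (\<lambda>a. 2 * a) ` Field r \<union> (\<lambda>a. Suc (2 * a)) ` Field s" "x \<noteq> y"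
    then show "(x, y) \<in> ?t \<or> (y, x) \<in> ?t"
      using lin(4,8) unfolding total_on_def by (elim UnE imageE) simp_all
  qed
  moreover have "?t \<subseteq> Field ?t \<times> Field ?t"
    by (auto intro: FieldI1 FieldI2)
  moreover have "wf (?t - Id)"
  proof (rule wfI_min)
    fix x and Q :: "nat set" assume x: "x \<in> Q"
    show "\<exists>z\<in>Q. \<forall>y. (y, z) \<in> ?t - Id \<longrightarrow> y \<notin> Q"
    proof (cases "\<exists>a. 2 * a \<in> Q")
      case True
      then obtain a where "2 * a \<in> Q" "\<And>b. (b, a) \<in> r - Id \<Longrightarrow> 2 * b \<notin> Q"
        using wfE_min[OF wf(1), of _ "{a. 2 * a \<in> Q}"] by auto
      then show ?thesis
      proof (intro bexI[of _ "2 * a"] allI impI)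
        fix y assume y: "(y, 2 * a) \<in> ?t - Id"
        show "y \<notin> Q"
          using y \<open>\<And>b. (b, a) \<in> r - Id \<Longrightarrow> 2 * b \<notin> Q\<close> by (cases y rule: even_odd_cases) auto
      qed
    next
      case False
      then obtain b where "Suc (2 * b) \<in> Q"
        using x by (metis even_odd_cases)
      then obtain a where "Suc (2 * a) \<in> Q" "\<And>b. (b, a) \<in> s - Id \<Longrightarrow> Suc (2 * b) \<notin> Q"
        using wfE_min[OF wf(2), of _ "{a. Suc (2 * a) \<in> Q}"] by auto
      then show ?thesis
      proof (intro bexI[of _ "Suc (2 * a)"] allI impI)
        fix y assume y: "(y, Suc (2 * a)) \<in> ?t - Id"
        show "y \<notin> Q"
          using y False \<open>\<And>b. (b, a) \<in> s - Id \<Longrightarrow> Suc (2 * b) \<notin> Q\<close>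
          by (cases y rule: even_odd_cases) auto
      qed
    qed
  qed
  ultimately show ?thesis
    by (simp add: order_on_defs)
qed

lemma nat_osum_ordIso:
  assumes "(r, r') \<in> ordIso" "(s, s') \<in> ordIso"
  shows "(nat_osum r s, nat_osum r' s') \<in> ordIso"
proof -
  from assms obtain f g where
    wo: "Well_order r" "Well_order r'" "Well_order s" "Well_order s'" and
    f: "iso r r' f" and g: "iso s s' g"
    unfolding ordIso_def by auto
  define h where "h n = (if even n then 2 * f (n div 2) else Suc (2 * g (n div 2)))" for n
  have h [simp]: "h (2 * a) = 2 * f a" "h (Suc (2 * a)) = Suc (2 * g a)" for a
    by (simp_all add: h_def)
  note F = Field_nat_osum[OF wo(1,3)] Field_nat_osum[OF wo(2,4)]
  have bij: "bij_betw f (Field r) (Field r')" "bij_betw g (Field s) (Field s')"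
    and mono: "\<And>a b. a \<in> Field r \<Longrightarrow> b \<in> Field r \<Longrightarrow> (a, b) \<in> r \<longleftrightarrow> (f a, f b) \<in> r'"
      "\<And>a b. a \<in> Field s \<Longrightarrow> b \<in> Field s \<Longrightarrow> (a, b) \<in> s \<longleftrightarrow> (g a, g b) \<in> s'"
    using f g by (auto simp: iso_iff2)
  have inj: "inj_on h (Field (nat_osum r s))"
    unfolding F
  proof (rule inj_onI)
    fix x y
    assume xy: "x \<in> (\<lambda>a. 2 * a) ` Field r \<union> (\<lambda>a. Suc (2 * a)) ` Field s"
      "y \<in> (\<lambda>a. 2 * a) ` Field r \<union> (\<lambda>a. Suc (2 * a)) ` Field s" "h x = h y"
    have parity: "2 * a \<noteq> Suc (2 * b)" "Suc (2 * b) \<noteq> 2 * a" for a b :: nat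
      by presburger+
    have "inj_on f (Field r)" "inj_on g (Field s)"
      using bij by (simp_all add: bij_betw_def)
    then show "x = y"
      using xy parity by (elim UnE imageE) (simp_all add: inj_on_eq_iff)
  qed
  have "h ` Field (nat_osum r s) = Field (nat_osum r' s')"
  proof -
    have "f ` Field r = Field r'" "g ` Field s = Field s'"
      using bij by (simp_all add: bij_betw_def)
    then show ?thesis
      unfolding F image_Un image_image h by (metis image_image)
  qed
  moreover have "\<forall>a\<in>Field (nat_osum r s). \<forall>b\<in>Field (nat_osum r s).
      (a, b) \<in> nat_osum r s \<longleftrightarrow> (h a, h b) \<in> nat_osum r' s'"
  proof -
    have "\<And>a. a \<in> Field r \<Longrightarrow> f a \<in> Field r'" "\<And>a. a \<in> Field s \<Longrightarrow> g a \<in> Field s'"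
      using bij by (auto simp: bij_betw_def)
    then show ?thesis
      unfolding F using mono by (intro ballI, elim UnE imageE) simp_all
  qed
  ultimately have "iso (nat_osum r s) (nat_osum r' s') h"
    using inj by (simp add: iso_iff2 bij_betw_def)
  then show ?thesis
    using wo by (auto simp: ordIso_def intro: Well_order_nat_osum)
qed

instantiation countable_ordinal :: "{zero, one, plus}"
begin

lift_definition zero_countable_ordinal :: countable_ordinal is "{} :: nat rel"
  by (simp add: ordIso_reflexive)

lift_definition one_countable_ordinal :: countable_ordinal is "{(0, 0)} :: nat rel"
  by (rule ordIso_reflexive) (auto simp: order_on_defs refl_on_def trans_def antisym_def
        total_on_def Field_def)

lift_definition plus_countable_ordinal ::
    "countable_ordinal \<Rightarrow> countable_ordinal \<Rightarrow> countable_ordinal" is nat_osum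
  by (rule nat_osum_ordIso)

instance ..

end

instantiation countable_ordinal :: wellorder
begin

lift_definition less_eq_countable_ordinal :: "countable_ordinal \<Rightarrow> countable_ordinal \<Rightarrow> bool"
  is "\<lambda>r s. (r, s) \<in> ordLeq"
  by (meson ordIso_ordLeq_trans ordLeq_ordIso_trans ordIso_symmetric)

lift_definition less_countable_ordinal :: "countable_ordinal \<Rightarrow> countable_ordinal \<Rightarrow> bool"
  is "\<lambda>r s. (r, s) \<in> ordLess"
  by (meson ordIso_ordLess_trans ordLess_ordIso_trans ordIso_symmetric)

instance
proof
  fix x y z :: countable_ordinal
  have wo: "(r, r) \<in> ordIso \<Longrightarrow> Well_order r" for r :: "nat rel"
    by (simp add: ordIso_def)
  show "x < y \<longleftrightarrow> x \<le> y \<and> \<not> y \<le> x"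
    by transfer (metis wo not_ordLess_ordLeq ordLess_imp_ordLeq ordLess_or_ordLeq)
  show "x \<le> x"
    by transfer (auto intro: ordLeq_reflexive wo)
  show "x \<le> y \<Longrightarrow> y \<le> z \<Longrightarrow> x \<le> z"
    by transfer (rule ordLeq_transitive)
  show "x \<le> y \<Longrightarrow> y \<le> x \<Longrightarrow> x = y"
    by transfer (simp add: ordIso_iff_ordLeq)
  show "x \<le> y \<or> y \<le> x"
    by transfer (metis ordLeq_total wo)
next
  fix P and a :: countable_ordinal
  assume step: "\<And>x :: countable_ordinal. (\<And>y. y < x \<Longrightarrow> P y) \<Longrightarrow> P x"
  have "{(x :: countable_ordinal, y). x < y} \<subseteq> inv_image ordLess rep_countable_ordinal"
    by (auto simp: less_countable_ordinal.rep_eq)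
  then have "wf {(x :: countable_ordinal, y). x < y}"
    by (rule wf_subset[OF wf_inv_image[OF wf_ordLess]])
  then show "P a"
    by (rule wf_induct_rule) (auto intro: step)
qed

end

definition limit_ordinal :: "countable_ordinal \<Rightarrow> bool" where
  "limit_ordinal l \<longleftrightarrow> l \<noteq> 0 \<and> (\<nexists>a. l = a + 1)"


section \<open>The Borel hierarchy\<close>

text \<open>
  The space \<open>2\<^sup>I\<close>. Its points are the functions that are \<open>undefined\<close> outside \<open>I\<close>, hence all functions
  if \<open>I = UNIV\<close>.
\<close>

definition cantor_space :: "nat set \<Rightarrow> (nat \<Rightarrow> bool) topology" where
  "cantor_space I = product_topology (\<lambda>_. discrete_topology UNIV) I"

text \<open>
  Level 0 consists of the clopen sets. At positive levels the condition \<open>\<beta> n < \<alpha>\<close> already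
  forces \<open>\<alpha> \<noteq> 0\<close>.
\<close>

inductive Sigma0 :: "'a topology \<Rightarrow> countable_ordinal \<Rightarrow> 'a set \<Rightarrow> bool"
  and Pi0 :: "'a topology \<Rightarrow> countable_ordinal \<Rightarrow> 'a set \<Rightarrow> bool"
  for X :: "'a topology"
where
  Sigma0_clopen: "openin X S \<Longrightarrow> closedin X S \<Longrightarrow> Sigma0 X 0 S"
| Pi0_clopen: "openin X S \<Longrightarrow> closedin X S \<Longrightarrow> Pi0 X 0 S"
| Sigma0_Union: "(\<And>n :: nat. \<beta> n < \<alpha> \<and> Pi0 X (\<beta> n) (A n)) \<Longrightarrow> Sigma0 X \<alpha> (\<Union>n. A n)"
| Pi0_Inter: "(\<And>n :: nat. \<beta> n < \<alpha> \<and> Sigma0 X (\<beta> n) (A n)) \<Longrightarrow> Pi0 X \<alpha> (\<Inter>n. A n)"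

definition borel_set :: "'a topology \<Rightarrow> 'a set \<Rightarrow> bool" where
  "borel_set X S \<longleftrightarrow> S \<in> sigma_sets (topspace X) {U. openin X U}"

definition borel_rank :: "'a topology \<Rightarrow> 'a set \<Rightarrow> countable_ordinal" where
  "borel_rank X S = (LEAST \<alpha>. Sigma0 X \<alpha> S \<or> Pi0 X \<alpha> S)"

definition Sigma0_measurable ::
    "countable_ordinal \<Rightarrow> ((nat \<Rightarrow> bool) \<Rightarrow> (nat \<Rightarrow> bool)) \<Rightarrow> bool" where
  "Sigma0_measurable \<alpha> f \<longleftrightarrow>
     (\<forall>U. openin (cantor_space UNIV) U \<longrightarrow> Sigma0 (cantor_space UNIV) \<alpha> (f -` U))"


section \<open>Tree functions\<close>

datatype gate = And_gate | Or_gate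

text \<open>
  Labeled trees in which every non-leaf vertex has exactly \<open>\<omega>\<close> many children, as is the case in
  all the trees \<open>T\<^sub>\<alpha>\<close>. A leaf carries the index of its variable.
\<close>

datatype gate_tree = Leaf nat | Node gate "nat \<Rightarrow> gate_tree"

text \<open>
  \<open>full_tree \<alpha> t\<close> says that the underlying unlabeled tree of \<open>t\<close> is (isomorphic to) \<open>T\<^sub>\<alpha>\<close>. At a
  limit, \<open>r n\<close> is the ordinal \<open>\<beta>\<close> for which the \<open>n\<close>-th child is a copy of \<open>T\<^sub>\<beta>\<close>; each \<open>\<beta> < \<alpha>\<close>
  has to occur \<open>\<omega>\<close> many times.
\<close>

inductive full_tree :: "countable_ordinal \<Rightarrow> gate_tree \<Rightarrow> bool" where
  full_tree_zero: "full_tree 0 (Leaf i)"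
| full_tree_succ: "(\<And>n. full_tree \<alpha> (c n)) \<Longrightarrow> full_tree (\<alpha> + 1) (Node g c)"
| full_tree_limit:
    "limit_ordinal \<alpha> \<Longrightarrow> (\<And>n. r n < \<alpha> \<and> full_tree (r n) (c n)) \<Longrightarrow>
     (\<And>\<beta>. \<beta> < \<alpha> \<Longrightarrow> infinite {n. r n = \<beta>}) \<Longrightarrow> full_tree \<alpha> (Node g c)"

primrec alternating :: "gate_tree \<Rightarrow> bool" where
  "alternating (Leaf i) \<longleftrightarrow> True"
| "alternating (Node g c) \<longleftrightarrow>
     (\<forall>n. alternating (c n)) \<and> (\<forall>n h d. c n = Node h d \<longrightarrow> h \<noteq> g)"

primrec leaf_labels :: "gate_tree \<Rightarrow> nat set" where
  "leaf_labels (Leaf i) = {i}"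
| "leaf_labels (Node g c) = (\<Union>n. leaf_labels (c n))"

text \<open>Distinct leaves carry distinct labels.\<close>

primrec injectively_labeled :: "gate_tree \<Rightarrow> bool" where
  "injectively_labeled (Leaf i) \<longleftrightarrow> True"
| "injectively_labeled (Node g c) \<longleftrightarrow>
     (\<forall>n. injectively_labeled (c n)) \<and> disjoint_family (\<lambda>n. leaf_labels (c n))"

definition full_alternating_tree :: "countable_ordinal \<Rightarrow> gate_tree \<Rightarrow> bool" where
  "full_alternating_tree \<alpha> t \<longleftrightarrow> full_tree \<alpha> t \<and> injectively_labeled t \<and> alternating t"

primrec eval_tree :: "gate_tree \<Rightarrow> (nat \<Rightarrow> bool) \<Rightarrow> bool" where
  "eval_tree (Leaf i) = (\<lambda>x. x i)"
| "eval_tree (Node g c) =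
     (\<lambda>x. case g of And_gate \<Rightarrow> \<forall>n. eval_tree (c n) x | Or_gate \<Rightarrow> \<exists>n. eval_tree (c n) x)"

definition tree_function :: "countable_ordinal \<Rightarrow> ((nat \<Rightarrow> bool) \<Rightarrow> bool) \<Rightarrow> bool" where
  "tree_function \<alpha> g \<longleftrightarrow> (\<exists>t. full_alternating_tree \<alpha> t \<and> g = eval_tree t)"


section \<open>Restrictions\<close>

text \<open>\<open>None\<close> stands for \<open>*\<close>.\<close>

type_synonym restriction = "nat \<Rightarrow> bool option"

definition stars :: "restriction \<Rightarrow> nat set" where
  "stars \<rho> = {i. \<rho> i = None}"

text \<open>
  The restricted function is only meant to be applied to points of \<^term>\<open>cantor_space (stars \<rho>)\<close>;
  its value depends only on the coordinates in \<^term>\<open>stars \<rho>\<close>.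
\<close>

definition restricted_fun :: "((nat \<Rightarrow> bool) \<Rightarrow> 'b) \<Rightarrow> restriction \<Rightarrow> (nat \<Rightarrow> bool) \<Rightarrow> 'b" where
  "restricted_fun f \<rho> x = f (\<lambda>i. case \<rho> i of None \<Rightarrow> x i | Some b \<Rightarrow> b)"

end

theory Submission
  imports Defs
begin

text \<open>
  Let \<open>t\<close> be a tree of rank \<open>\<alpha> + \<beta>\<close> that computes \<open>g\<close>. The map \<open>f\<close> outputs, one bit per vertex, the
  values of all the vertices of \<open>t\<close> whose subtree has rank at most \<open>\<alpha>\<close>; there are countably many.

  By induction on the tree, the value of a vertex of rank \<open>\<gamma>\<close> is a \<open>\<Sigma>\<^sup>0\<^sub>\<gamma>\<close> condition if the vertex is
  a disjunction and a \<open>\<Pi>\<^sup>0\<^sub>\<gamma>\<close> condition if it is a conjunction, since gates alternate and the children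
  have smaller rank. Hence each bit of \<open>f\<close> and its negation is \<open>\<Sigma>\<^sup>0\<close> at level \<open>\<alpha> + 1\<close>, and since there are
  only countably many cylinders, \<open>f\<close> is measurable at that level.

  If \<open>f\<^sup>\<rho>\<close> is continuous, then each vertex of rank at most \<open>\<alpha>\<close> becomes a clopen condition under
  \<open>\<rho>\<close>: those vertices may be treated as leaves, and a vertex of rank \<open>\<alpha> + \<gamma>\<close> then has effective rank \<open>\<gamma>\<close>.
  The same induction, started at these vertices, puts the root in \<open>\<Sigma>\<^sup>0\<^sub>\<beta>\<close> or \<open>\<Pi>\<^sup>0\<^sub>\<beta>\<close>.

  Both inductions are instances of \<open>full_tree_gate_class\<close>; the first one is the case \<open>\<alpha> = 0\<close>. It
  rests on the fact that an ordinal below \<open>\<alpha> + \<gamma>\<close> is below \<open>\<alpha>\<close> or of the form \<open>\<alpha> + \<gamma>'\<close> with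
  \<open>\<gamma>' < \<gamma>\<close> (\<open>countable_ordinal_less_add_cases\<close>). Measurability is deduced from the single bits by
  \<open>Sigma0_measurableI\<close>.
\<close>

section \<open>Sums of countable ordinals\<close>

lemma zero_le_countable_ordinal: "0 \<le> (a :: countable_ordinal)"
proof transfer
  fix r :: "nat rel"
  assume "(r, r) \<in> ordIso"
  then have "Well_order r" by (simp add: ordIso_def)
  then show "({}, r) \<in> ordLeq" 
    by (auto simp: ordLeq_def embed_def bij_betw_def)
qed

lemma ordIso_double:
  assumes "Well_order r"
  shows "(r, {(2 * a, 2 * b) | a b. (a, b) \<in> (r :: nat rel)}) \<in> ordIso"
  using dir_image_ordIso[OF assms, of "\<lambda>a. 2 * a"] by (simp add: dir_image_def inj_on_def)

lemma ordIso_Suc_double: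
  assumes "Well_order r"
  shows "(r, {(2 * a + 1, 2 * b + 1) | a b. (a, b) \<in> (r :: nat rel)}) \<in> ordIso"
  using dir_image_ordIso[OF assms, of "\<lambda>a. 2 * a + 1"] by (simp add: dir_image_def inj_on_def)

lemma countable_ordinal_add_0: "a + 0 = (a :: countable_ordinal)"
proof transfer
  fix r :: "nat rel"
  assume "(r, r) \<in> ordIso"
  then have "Well_order r" by (simp add: ordIso_def)
  moreover have "nat_osum r {} = {(2 * a, 2 * b) | a b. (a, b) \<in> r}"
    unfolding nat_osum_def by auto
  ultimately show "(nat_osum r {}, r) \<in> ordIso"
    by (simp add: ordIso_double ordIso_symmetric)
qed

lemma countable_ordinal_0_add: "0 + a = (a :: countable_ordinal)"
proof transfer
  fix r :: "nat rel"
  assume "(r, r) \<in> ordIso"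
  then have "Well_order r" by (simp add: ordIso_def)
  moreover have "nat_osum {} r = {(2 * a + 1, 2 * b + 1) | a b. (a, b) \<in> r}"
    unfolding nat_osum_def by auto
  ultimately show "(nat_osum {} r, r) \<in> ordIso"
    using ordIso_Suc_double[of r] by (simp add: ordIso_symmetric)
qed

lemma nat_osum_initial_segment_even:
  "Restr (nat_osum r s) (underS (nat_osum r s) (2 * b))
    = {(2 * x, 2 * y) | x y. (x, y) \<in> Restr r (underS r b)}" (is "?L = ?R")
proof (rule set_eqI, clarify)
  fix x y :: nat
  have "2 * a \<noteq> Suc (2 * c)" "Suc (2 * c) \<noteq> 2 * a" for a c :: nat by presburger+
  then show "(x, y) \<in> ?L \<longleftrightarrow> (x, y) \<in> ?R"
    by (cases x rule: even_odd_cases; cases y rule: even_odd_cases) (auto simp: underS_def)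
qed

lemma nat_osum_initial_segment_odd:
  assumes s: "Well_order s" and b: "b \<in> Field s"
  shows "Restr (nat_osum r s) (underS (nat_osum r s) (Suc (2 * b)))
    = nat_osum r (Restr s (underS s b))" (is "?L = ?R")
proof (rule set_eqI, clarify)
  fix x y :: nat
  have F: "Field (Restr s (underS s b)) = underS s b"
  proof -
    have "Refl s" using s by (auto simp: order_on_defs)
    moreover have "underS s b \<subseteq> Field s" by (auto simp: underS_def Field_def)
    ultimately show ?thesis by (rule Refl_Field_Restr2)
  qed
  have "2 * a \<noteq> Suc (2 * c)" for a c :: nat by presburger
  then show "(x, y) \<in> ?L \<longleftrightarrow> (x, y) \<in> ?R"
    using b F
    by (cases x rule: even_odd_cases; cases y rule: even_odd_cases)
       (auto simp: underS_def intro: FieldI1 FieldI2)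
qed

text \<open>
  An order below \<open>nat_osum r s\<close> is isomorphic to a proper initial segment of it, and such a segment
  is cut off either by an element of the copy of \<open>r\<close> or by an element of the copy of \<open>s\<close>.
\<close>

lemma ordLess_nat_osum:
  assumes r: "Well_order r" and s: "Well_order s" and t: "(t, nat_osum r s) \<in> ordLess"
  shows "(t, r) \<in> ordLess \<or> (\<exists>s'. (s', s) \<in> ordLess \<and> (t, nat_osum r s') \<in> ordIso)"
proof -
  have wo: "Well_order (nat_osum r s)" using r s by (rule Well_order_nat_osum)
  have "Well_order t" using t by (auto simp: ordLess_def)
  with t wo obtain c where c: "c \<in> Field (nat_osum r s)"
      and iso: "(t, Restr (nat_osum r s) (underS (nat_osum r s) c)) \<in> ordIso"
    by (auto simp: ordLess_iff_ordIso_Restr)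
  from c consider b where "b \<in> Field r" "c = 2 * b" | b where "b \<in> Field s" "c = Suc (2 * b)"
    unfolding Field_nat_osum[OF r s] by auto
  then show ?thesis
  proof cases
    case 1
    have "Well_order (Restr r (underS r b))" by (rule Well_order_Restr[OF r])
    then have "(t, Restr r (underS r b)) \<in> ordIso"
      using iso ordIso_double ordIso_symmetric ordIso_transitive
      unfolding 1 nat_osum_initial_segment_even by blast
    then show ?thesis
      using underS_Restr_ordLess[OF r, of b] 1 ordIso_ordLess_trans by blast
  next
    case 2
    have "(Restr s (underS s b), s) \<in> ordLess"
      using underS_Restr_ordLess[OF s, of b] 2 by blast
    then show ?thesis
      using iso unfolding 2(2) nat_osum_initial_segment_odd[OF s 2(1)] by blast
  qed
qed

lemma countable_ordinal_less_add_cases: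
  fixes a b d :: countable_ordinal
  assumes "d < a + b"
  obtains "d < a" | c where "c < b" "d = a + c"
proof -
  have "d < a + b \<Longrightarrow> d < a \<or> (\<exists>c<b. d = a + c)"
  proof transfer
    fix d a b :: "nat rel"
    assume "(a, a) \<in> ordIso" "(b, b) \<in> ordIso" and d: "(d, nat_osum a b) \<in> ordLess"
    then have "Well_order a" "Well_order b" by (auto simp: ordIso_def)
    from ordLess_nat_osum[OF this d]
    show "(d, a) \<in> ordLess \<or>
      (\<exists>c\<in>{c. (c, c) \<in> ordIso}. (c, b) \<in> ordLess \<and> (d, nat_osum a c) \<in> ordIso)"
      using ordIso_reflexive unfolding ordLess_def by blast
  qed
  with assms that show thesis by blast
qed

lemma countable_ordinal_less_add_1: "a < a + (1 :: countable_ordinal)"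
proof transfer
  fix r :: "nat rel"
  assume "(r, r) \<in> ordIso"
  then have r: "Well_order r" by (simp add: ordIso_def)
  let ?s = "{(0, 0)} :: nat rel"
  have s: "Well_order ?s"
    by (auto simp: order_on_defs refl_on_def trans_def antisym_def total_on_def Field_def)
  have 0: "0 \<in> Field ?s" by (simp add: Field_def)
  have "Restr ?s (underS ?s 0) = {}" by (auto simp: underS_def)
  then have "Restr (nat_osum r ?s) (underS (nat_osum r ?s) (Suc (2 * 0)))
      = {(2 * a, 2 * b) | a b. (a, b) \<in> r}"
    unfolding nat_osum_initial_segment_odd[OF s 0] by (auto simp: nat_osum_def)
  then have "(r, Restr (nat_osum r ?s) (underS (nat_osum r ?s) (Suc (2 * 0)))) \<in> ordIso"
    using ordIso_double[OF r] by simp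
  moreover have "Suc (2 * 0) \<in> Field (nat_osum r ?s)"
    using 0 unfolding Field_nat_osum[OF r s] by blast
  \<comment> \<open>the order \<open>r\<close> is the initial segment of \<open>nat_osum r ?s\<close> below its only odd element\<close>
  ultimately show "(r, nat_osum r ?s) \<in> ordLess"
    using ordLess_iff_ordIso_Restr[OF Well_order_nat_osum[OF r s] r] by blast
qed


section \<open>Closure properties of the Borel classes\<close>

lemma Sigma0_UnionI:
  assumes "\<And>n :: nat. \<exists>\<beta><\<alpha>. Pi0 X \<beta> (A n)"
  shows "Sigma0 X \<alpha> (\<Union>n. A n)"
proof -
  from assms obtain \<beta> where "\<And>n. \<beta> n < \<alpha> \<and> Pi0 X (\<beta> n) (A n)" by metis
  then show ?thesis by (rule Sigma0_Union)
qed

lemma Pi0_InterI: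
  assumes "\<And>n :: nat. \<exists>\<beta><\<alpha>. Sigma0 X \<beta> (A n)"
  shows "Pi0 X \<alpha> (\<Inter>n. A n)"
proof -
  from assms obtain \<beta> where "\<And>n. \<beta> n < \<alpha> \<and> Sigma0 X (\<beta> n) (A n)" by metis
  then show ?thesis by (rule Pi0_Inter)
qed

lemma Sigma0_if_Pi0_less: "Pi0 X \<beta> S \<Longrightarrow> \<beta> < \<alpha> \<Longrightarrow> Sigma0 X \<alpha> S"
  using Sigma0_UnionI[of \<alpha> X "\<lambda>_. S"] by auto

lemma Pi0_if_Sigma0_less: "Sigma0 X \<beta> S \<Longrightarrow> \<beta> < \<alpha> \<Longrightarrow> Pi0 X \<alpha> S"
  using Pi0_InterI[of \<alpha> X "\<lambda>_. S"] by auto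

lemma Sigma0_if_clopen:
  assumes "openin X S" "closedin X S"
  shows "Sigma0 X \<alpha> S"
proof (cases "\<alpha> = 0")
  case False
  then have "0 < \<alpha>" using zero_le_countable_ordinal[of \<alpha>] by simp
  then show ?thesis using Pi0_clopen[OF assms] Sigma0_if_Pi0_less by blast
qed (use assms in \<open>auto intro: Sigma0_clopen\<close>)

lemma Pi0_if_clopen:
  assumes "openin X S" "closedin X S"
  shows "Pi0 X \<alpha> S"
proof (cases "\<alpha> = 0")
  case False
  then have "0 < \<alpha>" using zero_le_countable_ordinal[of \<alpha>] by simp
  then show ?thesis using Sigma0_clopen[OF assms] Pi0_if_Sigma0_less by blast
qed (use assms in \<open>auto intro: Pi0_clopen\<close>)

lemma Sigma0_cases:
  assumes "Sigma0 X \<alpha> S"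
  obtains "openin X S" "closedin X S"
  | A where "S = (\<Union>n :: nat. A n)" "\<And>n. \<exists>\<beta><\<alpha>. Pi0 X \<beta> (A n)"
  using assms by (cases rule: Sigma0.cases) blast+

lemma Pi0_cases:
  assumes "Pi0 X \<alpha> S"
  obtains "openin X S" "closedin X S"
  | A where "S = (\<Inter>n :: nat. A n)" "\<And>n. \<exists>\<beta><\<alpha>. Sigma0 X \<beta> (A n)"
  using assms by (cases rule: Pi0.cases) blast+

lemma Sigma0_0_iff: "Sigma0 X 0 S \<longleftrightarrow> openin X S \<and> closedin X S"
proof
  assume "Sigma0 X 0 S"
  then show "openin X S \<and> closedin X S"
    using zero_le_countable_ordinal by (cases rule: Sigma0_cases) (auto simp: leD)
qed (simp add: Sigma0_clopen)

lemma Sigma0_mono: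
  assumes "Sigma0 X \<alpha> S" "\<alpha> \<le> \<beta>"
  shows "Sigma0 X \<beta> S"
  using assms(1)
proof (cases rule: Sigma0_cases)
  case (2 A)
  then show ?thesis using assms(2) by (metis Sigma0_UnionI less_le_trans)
qed (rule Sigma0_if_clopen)

lemma Pi0_mono:
  assumes "Pi0 X \<alpha> S" "\<alpha> \<le> \<beta>"
  shows "Pi0 X \<beta> S"
  using assms(1)
proof (cases rule: Pi0_cases)
  case (2 A)
  then show ?thesis using assms(2) by (metis Pi0_InterI less_le_trans)
qed (rule Pi0_if_clopen)

lemma Sigma0_Pi0_complement:
  "Sigma0 X \<alpha> S \<Longrightarrow> Pi0 X \<alpha> (topspace X - S)"
  "Pi0 X \<alpha> S \<Longrightarrow> Sigma0 X \<alpha> (topspace X - S)"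
proof (induction rule: Sigma0_Pi0.inducts)
  case (Sigma0_Union \<beta> \<alpha> A)
  have "topspace X - (\<Union>n. A n) = (\<Inter>n. topspace X - A n)" by auto
  then show ?case using Sigma0_Union by (metis Pi0_InterI)
next
  case (Pi0_Inter \<beta> \<alpha> A)
  have "topspace X - (\<Inter>n. A n) = (\<Union>n. topspace X - A n)" by auto
  then show ?case using Pi0_Inter by (metis Sigma0_UnionI)
qed (auto intro!: Sigma0_clopen Pi0_clopen)

lemma Sigma0_Pi0_imp_borel_set:
  "Sigma0 X \<alpha> S \<Longrightarrow> borel_set X S"
  "Pi0 X \<alpha> S \<Longrightarrow> borel_set X S"
proof (induction rule: Sigma0_Pi0.inducts)
  case (Pi0_Inter \<beta> \<alpha> A)
  then show ?case
    unfolding borel_set_def using openin_subset by (intro sigma_sets_Inter) blast+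
qed (auto simp: borel_set_def intro: sigma_sets.intros)

text \<open>
  At positive levels clopen sets are covered as well, as unions of constant sequences.
\<close>

lemma Sigma0_positive:
  assumes "Sigma0 X \<alpha> S" and "\<alpha> \<noteq> 0"
  shows "\<exists>B. S = (\<Union>k :: nat. B k) \<and> (\<forall>k. \<exists>\<beta><\<alpha>. Pi0 X \<beta> (B k))"
  using assms(1)
proof (cases rule: Sigma0_cases)
  case 1
  have "0 < \<alpha>" using \<open>\<alpha> \<noteq> 0\<close> zero_le_countable_ordinal[of \<alpha>] by simp
  then have "\<forall>k :: nat. \<exists>\<beta><\<alpha>. Pi0 X \<beta> S" using 1 Pi0_clopen by blast
  then show ?thesis by (intro exI[of _ "\<lambda>_. S"]) auto
qed auto

lemma Sigma0_countable_Union: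
  assumes A: "\<And>n :: nat. Sigma0 X \<alpha> (A n)" and "\<alpha> \<noteq> 0"
  shows "Sigma0 X \<alpha> (\<Union>n. A n)"
proof -
  have "\<exists>B. A n = (\<Union>k :: nat. B k) \<and> (\<forall>k. \<exists>\<beta><\<alpha>. Pi0 X \<beta> (B k))" for n
    using A[of n] \<open>\<alpha> \<noteq> 0\<close> by (rule Sigma0_positive)
  then obtain B where B: "\<And>n. A n = (\<Union>k :: nat. B n k)" "\<And>n k. \<exists>\<beta><\<alpha>. Pi0 X \<beta> (B n k)"
    by metis
  have "(\<Union>n. A n) = (\<Union>m. case prod_decode m of (n, k) \<Rightarrow> B n k)"
    unfolding B(1)
  proof (intro equalityI subsetI; clarsimp split: prod.splits)
    fix x n k
    assume "x \<in> B n k"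
    then show "\<exists>m. \<forall>n k. prod_decode m = (n, k) \<longrightarrow> x \<in> B n k"
      by (intro exI[of _ "prod_encode (n, k)"]) simp
  next
    fix x m
    assume "\<forall>n k. prod_decode m = (n, k) \<longrightarrow> x \<in> B n k"
    then show "\<exists>n k. x \<in> B n k" by (metis surj_pair)
  qed
  moreover have "Sigma0 X \<alpha> (\<Union>m. case prod_decode m of (n, k) \<Rightarrow> B n k)"
    using B(2) by (intro Sigma0_UnionI) (auto split: prod.splits)
  ultimately show ?thesis by simp
qed

lemma Sigma0_Pi0_subset_topspace:
  "Sigma0 X \<alpha> S \<Longrightarrow> S \<subseteq> topspace X"
  "Pi0 X \<alpha> S \<Longrightarrow> S \<subseteq> topspace X"
  by (induction rule: Sigma0_Pi0.inducts) (auto dest: openin_subset)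

lemma Sigma0_Un:
  assumes "Sigma0 X \<alpha> S" "Sigma0 X \<alpha> T"
  shows "Sigma0 X \<alpha> (S \<union> T)"
proof (cases "\<alpha> = 0")
  case True
  then show ?thesis using assms by (auto simp: Sigma0_0_iff)
next
  case False
  have "(\<Union>n. if n = (0 :: nat) then S else T) = S \<union> T"
    by (auto split: if_splits)
  then show ?thesis
    using Sigma0_countable_Union[of X \<alpha> "\<lambda>n. if n = 0 then S else T"] assms False by auto
qed

lemma Pi0_Int:
  assumes "Pi0 X \<alpha> S" "Pi0 X \<alpha> T"
  shows "Pi0 X \<alpha> (S \<inter> T)"
proof -
  have "Pi0 X \<alpha> (topspace X - ((topspace X - S) \<union> (topspace X - T)))"
    using assms by (intro Sigma0_Pi0_complement(1) Sigma0_Un Sigma0_Pi0_complement(2))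
  moreover have "topspace X - ((topspace X - S) \<union> (topspace X - T)) = S \<inter> T"
    using assms[THEN Sigma0_Pi0_subset_topspace(2)] by auto
  ultimately show ?thesis by simp
qed

text \<open>
  Intersecting two unions termwise gives a doubly indexed union. Since \<open>\<Pi>\<^sup>0\<close> classes increase with
  the level, each pair of terms lies in one class below \<open>\<alpha>\<close>, which is closed under intersection.
\<close>

lemma Sigma0_Int:
  assumes S: "Sigma0 X \<alpha> S" and T: "Sigma0 X \<alpha> T"
  shows "Sigma0 X \<alpha> (S \<inter> T)"
proof (cases "\<alpha> = 0")
  case True
  then show ?thesis using assms by (auto simp: Sigma0_0_iff)
next
  case False
  have *: "\<exists>B. R = (\<Union>n :: nat. B n) \<and> (\<forall>n. \<exists>\<beta><\<alpha>. Pi0 X \<beta> (B n))" if "Sigma0 X \<alpha> R" for R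
    using that False by (rule Sigma0_positive)
  from *[OF S] *[OF T] obtain A B where
    A: "S = (\<Union>n :: nat. A n)" "\<And>n. \<exists>\<beta><\<alpha>. Pi0 X \<beta> (A n)" and
    B: "T = (\<Union>n :: nat. B n)" "\<And>n. \<exists>\<beta><\<alpha>. Pi0 X \<beta> (B n)"
    by blast
  have "Sigma0 X \<alpha> (\<Union>m. A n \<inter> B m)" for n
  proof (rule Sigma0_UnionI)
    fix m
    obtain \<beta> \<gamma> where "\<beta> < \<alpha>" "Pi0 X \<beta> (A n)" "\<gamma> < \<alpha>" "Pi0 X \<gamma> (B m)"
      using A(2) B(2) by blast
    then have "max \<beta> \<gamma> < \<alpha>" "Pi0 X (max \<beta> \<gamma>) (A n \<inter> B m)"
      by (auto intro!: Pi0_Int elim: Pi0_mono)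
    then show "\<exists>\<beta><\<alpha>. Pi0 X \<beta> (A n \<inter> B m)" by blast
  qed
  then have "Sigma0 X \<alpha> (\<Union>n. \<Union>m. A n \<inter> B m)"
    using False by (rule Sigma0_countable_Union)
  then show ?thesis unfolding A(1) B(1) by auto
qed


section \<open>The Borel class of a tree function\<close>

primrec subtrees :: "gate_tree \<Rightarrow> gate_tree set" where
  "subtrees (Leaf i) = {Leaf i}"
| "subtrees (Node g c) = insert (Node g c) (\<Union>n. subtrees (c n))"

lemma self_in_subtrees: "t \<in> subtrees t"
  by (cases t) auto

lemma countable_subtrees: "countable (subtrees t)"
  by (induction t) auto

lemma alternating_subtree: "s \<in> subtrees t \<Longrightarrow> alternating t \<Longrightarrow> alternating s"
  by (induction t) auto

lemma ex_Leaf_subtree: "\<exists>i. Leaf i \<in> subtrees t"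
proof (induction t)
  case (Node g c)
  then have "\<exists>i. Leaf i \<in> subtrees (c 0)" by blast
  then show ?case by auto
qed simp

lemma full_tree_child:
  assumes "full_tree \<delta> (Node g c)"
  shows "\<exists>\<gamma><\<delta>. full_tree \<gamma> (c n)"
  using assms by (cases rule: full_tree.cases) (auto intro: countable_ordinal_less_add_1)

text \<open>
  Here \<open>e\<close> assigns to each point of \<open>X\<close> an input of the tree; it will be the identity or the
  completion of a partial input by a restriction. If the vertices of rank at most \<open>\<alpha>\<close> give clopen
  sets, the levels of the Borel hierarchy are counted from \<open>\<alpha>\<close> on: going up from the children of a
  vertex costs one level, because by alternation no child of a disjunction is a disjunction, so that
  all children are in lower \<open>\<Pi>\<^sup>0\<close> classes, and dually for conjunctions. A leaf falls under both
  conclusions.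
\<close>

lemma full_tree_gate_class:
  assumes "full_tree (\<alpha> + \<gamma>) t" "alternating t"
    and "\<And>s \<delta>. s \<in> subtrees t \<Longrightarrow> full_tree \<delta> s \<Longrightarrow> \<delta> \<le> \<alpha> \<Longrightarrow>
      openin X {x \<in> topspace X. eval_tree s (e x)} \<and> closedin X {x \<in> topspace X. eval_tree s (e x)}"
  shows "((\<nexists>c. t = Node And_gate c) \<longrightarrow> Sigma0 X \<gamma> {x \<in> topspace X. eval_tree t (e x)}) \<and>
         ((\<nexists>c. t = Node Or_gate c) \<longrightarrow> Pi0 X \<gamma> {x \<in> topspace X. eval_tree t (e x)})"
  using assms
proof (induction t arbitrary: \<gamma> rule: gate_tree.induct)
  case (Leaf i)
  have "full_tree 0 (Leaf i)" by (rule full_tree_zero)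
  with Leaf.prems(3)[of "Leaf i" 0] show ?case
    by (auto simp: zero_le_countable_ordinal intro: Sigma0_if_clopen Pi0_if_clopen)
next
  case (Node g c)
  define V where "V s = {x \<in> topspace X. eval_tree s (e x)}" for s
  show ?case
  proof (cases "\<gamma> = 0")
    case True
    then have "full_tree \<alpha> (Node g c)" using Node.prems(1) by (simp add: countable_ordinal_add_0)
    with Node.prems(3)[of "Node g c" \<alpha>] show ?thesis
      by (auto intro: Sigma0_if_clopen Pi0_if_clopen)
  next
    case False
    then have pos: "0 < \<gamma>" using zero_le_countable_ordinal[of \<gamma>] by simp
    have child: "\<exists>\<beta><\<gamma>. (g = Or_gate \<longrightarrow> Pi0 X \<beta> (V (c n))) \<and> (g = And_gate \<longrightarrow> Sigma0 X \<beta> (V (c n)))" for n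
    proof -
      from full_tree_child[OF Node.prems(1)] obtain \<delta> where
        \<delta>: "\<delta> < \<alpha> + \<gamma>" "full_tree \<delta> (c n)" by blast
      have sub: "subtrees (c n) \<subseteq> subtrees (Node g c)" by auto
      from \<delta>(1) show ?thesis
      proof (cases rule: countable_ordinal_less_add_cases)
        \<comment> \<open>the children of low rank are clopen and count as vertices of effective rank 0\<close>
        case 1
        then have "openin X (V (c n)) \<and> closedin X (V (c n))"
          unfolding V_def using Node.prems(3) sub self_in_subtrees \<delta>(2) less_imp_le by blast
        then show ?thesis using pos Sigma0_clopen Pi0_clopen by blast
      next
        case (2 \<beta>)
        have alt: "alternating (c n)" and neq: "\<And>d. c n \<noteq> Node g d"
          using Node.prems(2) by auto
        have "((\<nexists>d. c n = Node And_gate d) \<longrightarrow> Sigma0 X \<beta> (V (c n))) \<and>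
              ((\<nexists>d. c n = Node Or_gate d) \<longrightarrow> Pi0 X \<beta> (V (c n)))"
          unfolding V_def using \<delta>(2) 2 alt Node.prems(3) sub by (intro Node.IH) auto
        then show ?thesis using 2 neq by blast
      qed
    qed
    show ?thesis
    proof (cases g)
      case And_gate
      then have "V (Node g c) = (\<Inter>n. V (c n))" by (auto simp: V_def)
      moreover have "Pi0 X \<gamma> (\<Inter>n. V (c n))"
        using child And_gate by (intro Pi0_InterI) auto
      ultimately show ?thesis using And_gate by (simp add: V_def)
    next
      case Or_gate
      then have "V (Node g c) = (\<Union>n. V (c n))" by (auto simp: V_def)
      moreover have "Sigma0 X \<gamma> (\<Union>n. V (c n))"
        using child Or_gate by (intro Sigma0_UnionI) auto
      ultimately show ?thesis using Or_gate by (simp add: V_def)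
    qed
  qed
qed


section \<open>Measurable maps into the Cantor space\<close>

lemma topspace_cantor_space_UNIV: "topspace (cantor_space UNIV) = UNIV"
  by (simp add: cantor_space_def)

lemma clopen_coordinate:
  assumes "i \<in> I"
  shows "openin (cantor_space I) {x \<in> topspace (cantor_space I). x i}"
    and "closedin (cantor_space I) {x \<in> topspace (cantor_space I). x i}"
proof -
  have "continuous_map (cantor_space I) (discrete_topology UNIV) (\<lambda>x. x i)"
    unfolding cantor_space_def using assms by (rule continuous_map_product_projection)
  then show "openin (cantor_space I) {x \<in> topspace (cantor_space I). x i}"
      "closedin (cantor_space I) {x \<in> topspace (cantor_space I). x i}"
    using openin_continuous_map_preimage[of _ _ "\<lambda>x. x i" "{True}"]
      closedin_continuous_map_preimage[of _ _ "\<lambda>x. x i" "{True}"] by auto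
qed

lemma open_contains_cylinder:
  assumes "openin (cantor_space UNIV) U" "x \<in> U"
  shows "\<exists>N. {y. \<forall>i<N. y i = x i} \<subseteq> U"
proof -
  from assms obtain V where V: "finite {i. V i \<noteq> UNIV}" "\<And>i. x i \<in> V i" "Pi\<^sub>E UNIV V \<subseteq> U"
    unfolding cantor_space_def openin_product_topology_alt by (auto simp: PiE_iff)
  from V(1) obtain N where N: "\<And>i. V i \<noteq> UNIV \<Longrightarrow> i < N"
    using finite_nat_set_iff_bounded by auto
  have "y i \<in> V i" if "\<forall>i<N. y i = x i" for y i
    using N[of i] V(2)[of i] that by (cases "V i = UNIV") auto
  then have "{y. \<forall>i<N. y i = x i} \<subseteq> Pi\<^sub>E UNIV V" by (auto simp: PiE_iff)
  with V(3) show ?thesis by blast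
qed

text \<open>
  A cylinder is a finite intersection of conditions on single bits, and an open set is a union of
  countably many cylinders. Both signs of each bit are needed because \<open>\<Sigma>\<^sup>0\<^sub>\<alpha>\<close> need not be closed under
  complements.
\<close>

lemma Sigma0_measurableI:
  assumes "\<alpha> \<noteq> 0"
    and pos: "\<And>n. Sigma0 (cantor_space UNIV) \<alpha> {x. f x n}"
    and neg: "\<And>n. Sigma0 (cantor_space UNIV) \<alpha> {x. \<not> f x n}"
  shows "Sigma0_measurable \<alpha> f"
  unfolding Sigma0_measurable_def
proof (intro allI impI)
  let ?X = "cantor_space UNIV"
  have top: "Sigma0 ?X \<alpha> UNIV"
    by (rule Sigma0_if_clopen) (use openin_topspace[of ?X] closedin_topspace[of ?X] in
      \<open>simp_all add: topspace_cantor_space_UNIV\<close>)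
  have bot: "Sigma0 ?X \<alpha> {}"
    by (rule Sigma0_if_clopen) simp_all
  define cyl :: "bool list \<Rightarrow> (nat \<Rightarrow> bool) set" where
    "cyl bs = {y. \<forall>i<length bs. y i = bs ! i}" for bs
  have cyl: "Sigma0 ?X \<alpha> (f -` cyl bs)" for bs
  proof (induction bs rule: rev_induct)
    case Nil
    show ?case using top by (simp add: cyl_def)
  next
    case (snoc b bs)
    have "f -` cyl (bs @ [b]) = f -` cyl bs \<inter> {x. f x (length bs) = b}"
      by (auto simp: cyl_def nth_append less_Suc_eq)
    moreover have "Sigma0 ?X \<alpha> {x. f x (length bs) = b}"
      using pos neg by (cases b) auto
    ultimately show ?case using snoc by (simp add: Sigma0_Int)
  qed
  fix U assume U: "openin ?X U"
  \<comment> \<open>cylinders that are not contained in \<open>U\<close> are replaced by the empty set, to keep the union indexed by \<open>nat\<close>\<close>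
  define W where "W n = (let C = cyl (from_nat n) in if C \<subseteq> U then C else {})" for n
  have "U \<subseteq> (\<Union>n. W n)"
  proof
    fix x assume "x \<in> U"
    with U obtain N where N: "{y. \<forall>i<N. y i = x i} \<subseteq> U" using open_contains_cylinder by blast
    have "cyl (map x [0..<N]) = {y. \<forall>i<N. y i = x i}" by (simp add: cyl_def)
    then have "x \<in> W (to_nat (map x [0..<N]))" using N by (auto simp: W_def Let_def)
    then show "x \<in> (\<Union>n. W n)" by blast
  qed
  moreover have "(\<Union>n. W n) \<subseteq> U" by (auto simp: W_def Let_def split: if_splits)
  ultimately have "f -` U = (\<Union>n. f -` W n)" by auto
  moreover have "Sigma0 ?X \<alpha> (f -` W n)" for n
    using cyl bot by (auto simp: W_def Let_def)
  ultimately show "Sigma0 ?X \<alpha> (f -` U)"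
    using Sigma0_countable_Union \<open>\<alpha> \<noteq> 0\<close> by metis
qed


section \<open>Restricted tree functions\<close>

theorem theorem6p1:
  fixes \<alpha> \<beta> :: countable_ordinal and g :: "(nat \<Rightarrow> bool) \<Rightarrow> bool"
  assumes "tree_function (\<alpha> + \<beta>) g"
  shows "\<exists>f :: (nat \<Rightarrow> bool) \<Rightarrow> (nat \<Rightarrow> bool).
    Sigma0_measurable (\<alpha> + 1) f \<and>
    (\<forall>\<rho> :: restriction.
      continuous_map (cantor_space (stars \<rho>)) (cantor_space UNIV) (restricted_fun f \<rho>) \<longrightarrow>
      (let S = {x \<in> topspace (cantor_space (stars \<rho>)). restricted_fun g \<rho> x}
       in borel_set (cantor_space (stars \<rho>)) S \<and> borel_rank (cantor_space (stars \<rho>)) S \<le> \<beta>))"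
proof -
  from assms obtain t where t: "full_tree (\<alpha> + \<beta>) t" "alternating t" and g: "g = eval_tree t"
    unfolding tree_function_def full_alternating_tree_def by blast
  \<comment> \<open>the vertices whose values \<open>f\<close> outputs; \<open>C\<close> contains the leaves, so it can be enumerated\<close>
  define C where "C = {s \<in> subtrees t. \<exists>\<gamma>\<le>\<alpha>. full_tree \<gamma> s}"
  have "countable C" unfolding C_def using countable_subtrees by simp
  moreover have "C \<noteq> {}"
    using ex_Leaf_subtree[of t] zero_le_countable_ordinal full_tree_zero by (auto simp: C_def)
  ultimately obtain v :: "nat \<Rightarrow> gate_tree" where v: "range v = C"
    by (metis range_from_nat_into)
  define f where "f x n = eval_tree (v n) x" for x n
  have "Sigma0_measurable (\<alpha> + 1) f"
  proof (rule Sigma0_measurableI)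
    let ?X = "cantor_space UNIV"
    show "\<alpha> + 1 \<noteq> 0"
      using countable_ordinal_less_add_1[of \<alpha>] zero_le_countable_ordinal[of \<alpha>] by auto
    fix n
    from v obtain \<gamma> where \<gamma>: "v n \<in> subtrees t" "\<gamma> \<le> \<alpha>" "full_tree \<gamma> (v n)"
      unfolding C_def by blast
    \<comment> \<open>without restriction only the vertices of rank 0, the leaves, are clopen to begin with\<close>
    have full: "full_tree (0 + \<gamma>) (v n)" using \<gamma>(3) by (simp add: countable_ordinal_0_add)
    have alt: "alternating (v n)" using \<gamma>(1) t(2) by (rule alternating_subtree)
    have "Sigma0 ?X \<gamma> {x. f x n} \<or> Pi0 ?X \<gamma> {x. f x n}"
    proof -
      have "openin ?X {x \<in> topspace ?X. eval_tree s x} \<and> closedin ?X {x \<in> topspace ?X. eval_tree s x}"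
        if "full_tree \<delta> s" "\<delta> \<le> 0" for s \<delta>
      proof -
        have "s \<noteq> Node h c" for h c
        proof
          assume "s = Node h c"
          with that(1) obtain \<gamma> where "\<gamma> < \<delta>" using full_tree_child by blast
          then show False using that(2) zero_le_countable_ordinal[of \<gamma>] by simp
        qed
        then obtain i where "s = Leaf i" by (cases s) auto
        then show ?thesis using clopen_coordinate[of i UNIV] by simp
      qed
      with full_tree_gate_class[OF full alt, of ?X "\<lambda>x. x"] show ?thesis
        by (auto simp: f_def topspace_cantor_space_UNIV)
    qed
    then have "Sigma0 ?X (\<alpha> + 1) {x. f x n} \<and> Pi0 ?X (\<alpha> + 1) {x. f x n}"
      using le_less_trans[OF \<gamma>(2) countable_ordinal_less_add_1]
      by (auto intro: Sigma0_if_Pi0_less Pi0_if_Sigma0_less Sigma0_mono Pi0_mono less_imp_le)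
    moreover have "topspace ?X - {x. f x n} = {x. \<not> f x n}"
      by (auto simp: topspace_cantor_space_UNIV)
    ultimately show "Sigma0 ?X (\<alpha> + 1) {x. f x n}" "Sigma0 ?X (\<alpha> + 1) {x. \<not> f x n}"
      using Sigma0_Pi0_complement(2) by metis+
  qed
  moreover have "let S = {x \<in> topspace (cantor_space (stars \<rho>)). restricted_fun g \<rho> x}
       in borel_set (cantor_space (stars \<rho>)) S \<and> borel_rank (cantor_space (stars \<rho>)) S \<le> \<beta>"
    if cont: "continuous_map (cantor_space (stars \<rho>)) (cantor_space UNIV) (restricted_fun f \<rho>)"
    for \<rho> :: restriction
  proof -
    let ?X = "cantor_space (stars \<rho>)"
    define e where "e x i = (case \<rho> i of None \<Rightarrow> x i | Some b \<Rightarrow> b)" for x :: "nat \<Rightarrow> bool" and i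
    have r: "restricted_fun h \<rho> x = h (e x)" for h :: "(nat \<Rightarrow> bool) \<Rightarrow> 'z" and x
      unfolding restricted_fun_def e_def ..
    \<comment> \<open>continuity of the restricted \<open>f\<close> makes each of its coordinates a clopen condition\<close>
    have "openin ?X {x \<in> topspace ?X. eval_tree s (e x)} \<and> closedin ?X {x \<in> topspace ?X. eval_tree s (e x)}"
      if "s \<in> subtrees t" "full_tree \<delta> s" "\<delta> \<le> \<alpha>" for s \<delta>
    proof -
      have "s \<in> range v" using that unfolding v C_def by blast
      then obtain n where "s = v n" by blast
      then have "{x \<in> topspace ?X. eval_tree s (e x)} =
          {x \<in> topspace ?X. restricted_fun f \<rho> x \<in> {y \<in> topspace (cantor_space UNIV). y n}}"
        by (auto simp: r f_def topspace_cantor_space_UNIV)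
      then show ?thesis
        using openin_continuous_map_preimage[OF cont clopen_coordinate(1)]
          closedin_continuous_map_preimage[OF cont clopen_coordinate(2)] by simp
    qed
    with full_tree_gate_class[OF t, of ?X e]
    have "Sigma0 ?X \<beta> {x \<in> topspace ?X. eval_tree t (e x)} \<or>
        Pi0 ?X \<beta> {x \<in> topspace ?X. eval_tree t (e x)}"
      by auto
    then show ?thesis
      by (auto simp: Let_def r g borel_rank_def intro: Sigma0_Pi0_imp_borel_set Least_le)
  qed
  ultimately show ?thesis by blast
qed

end
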